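(* Let $L$ be a completely distributive lattice, $G$ a group, and $\mu$ an $L$-subgroup of $G$. Let $\eta$ be an abnormal $L$-subgroup of $\mu$. Then $\eta$ is self-normalizing in $\mu$, that is, $N(\eta)=\eta$.
   Context: $L$ is a completely distributive (in particular complete) lattice with greatest element $1$ and least element $0$; $G$ is a group. An $L$-subset of $G$ is a function $G\to L$; $\eta\subseteq\nu$ means $\eta(x)\le\nu(x)$ for all $x\in G$; unions of $L$-subsets are pointwise suprema. An $L$-subgroup of $G$ is an $L$-subset $\mu$ with $\mu(xy)\ge\mu(x)\wedge\mu(y)$ and $\mu(x^{-1})=\mu(x)$ for all $x,y\in G$. An $L$-subgroup of $\mu$ is an $L$-subgroup $\eta$ of $G$ with $\eta\subseteq\mu$. For $a\in L$, $x\in G$, the $L$-point $a_x$ is the $L$-subset with value $a$ at $x$ and $0$ elsewhere; $a_x\in\mu$ means $\mu(x)\ge a$. For $\eta$ an $L$-subgroup of $\mu$ and $a_z\in\mu$, the conjugate $\eta^{a_z}$ is the $L$-subset $\eta^{a_z}(x)=a\wedge\eta(zxz^{-1})$, $x\in G$ (it is an $L$-subgroup of $\mu$). For $L$-subsets $\eta,\nu\subseteq\mu$, $\langle\eta,\nu\rangle$ is the $L$-subgroup of $\mu$ generated by $\eta\cup\nu$, i.e. the pointwise infimum of all $L$-subgroups $\theta$ of $\mu$ with $\eta\cup\nu\subseteq\theta$. An $L$-subgroup $\eta$ of $\mu$ is an abnormal $L$-subgroup of $\mu$ if for every $L$-point $a_x\in\mu$ one has $a_x\in\langle\eta,\eta^{a_x}\rangle$.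 The normalizer of an $L$-subgroup $\eta$ of $\mu$ (in $\mu$) is the $L$-subset $N(\eta)=\bigcup\{a_z\in\mu\mid \eta^{a_z}\subseteq\eta\}$, i.e. $N(\eta)(x)=\bigvee\{a\in L\mid a\le\mu(x),\ \eta^{a_x}\subseteq\eta\}$ for $x\in G$. *)

theory Defs
  imports "HOL-Algebra.Group"
begin

text \<open>
  The lattice \<open>L\<close> is a type of class \<^class>\<open>complete_distrib_lattice\<close>, whose axiom is complete
  (not merely frame) distributivity. An \<open>L\<close>-subset of a group \<open>G\<close> is represented by a total
  function on the element type, of which only the values on \<^term>\<open>carrier G\<close> are meaningful;
  inclusion and equality of \<open>L\<close>-subsets are therefore relative to the carrier.
\<close>

definition L_included :: "('a, 'm) monoid_scheme \<Rightarrow> ('a \<Rightarrow> 'l::complete_distrib_lattice) \<Rightarrow> ('a \<Rightarrow> 'l) \<Rightarrow> bool"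
  where "L_included G \<eta> \<nu> \<longleftrightarrow> (\<forall>x\<in>carrier G. \<eta> x \<le> \<nu> x)"

definition L_equal :: "('a, 'm) monoid_scheme \<Rightarrow> ('a \<Rightarrow> 'l::complete_distrib_lattice) \<Rightarrow> ('a \<Rightarrow> 'l) \<Rightarrow> bool"
  where "L_equal G \<eta> \<nu> \<longleftrightarrow> (\<forall>x\<in>carrier G. \<eta> x = \<nu> x)"

definition L_subgroup :: "('a, 'm) monoid_scheme \<Rightarrow> ('a \<Rightarrow> 'l::complete_distrib_lattice) \<Rightarrow> bool"
  where "L_subgroup G \<mu> \<longleftrightarrow>
    (\<forall>x\<in>carrier G. \<forall>y\<in>carrier G. inf (\<mu> x) (\<mu> y) \<le> \<mu> (x \<otimes>\<^bsub>G\<^esub> y)) \<and>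
    (\<forall>x\<in>carrier G. \<mu> (inv\<^bsub>G\<^esub> x) = \<mu> x)"

text \<open>The ambient \<open>\<mu>\<close> comes before the \<open>L\<close>-subset it contains, here and below.\<close>

definition L_subgroup_of ::
    "('a, 'm) monoid_scheme \<Rightarrow> ('a \<Rightarrow> 'l::complete_distrib_lattice) \<Rightarrow> ('a \<Rightarrow> 'l) \<Rightarrow> bool"
  where "L_subgroup_of G \<mu> \<eta> \<longleftrightarrow> L_subgroup G \<eta> \<and> L_included G \<eta> \<mu>"

definition L_point :: "'l::complete_distrib_lattice \<Rightarrow> 'a \<Rightarrow> 'a \<Rightarrow> 'l"
  where "L_point a x = (\<lambda>y. if y = x then a else bot)"

definition L_point_in :: "'l::complete_distrib_lattice \<Rightarrow> 'a \<Rightarrow> ('a \<Rightarrow> 'l) \<Rightarrow> bool"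
  where "L_point_in a x \<mu> \<longleftrightarrow> a \<le> \<mu> x"

definition L_conjugate ::
    "('a, 'm) monoid_scheme \<Rightarrow> ('a \<Rightarrow> 'l::complete_distrib_lattice) \<Rightarrow> 'l \<Rightarrow> 'a \<Rightarrow> 'a \<Rightarrow> 'l"
  where "L_conjugate G \<eta> a z = (\<lambda>x. inf a (\<eta> (z \<otimes>\<^bsub>G\<^esub> x \<otimes>\<^bsub>G\<^esub> inv\<^bsub>G\<^esub> z)))"

text \<open>
  Below, \<^term>\<open>sup\<close>, \<^term>\<open>Sup\<close> and \<^term>\<open>Inf\<close> are applied to functions into \<open>L\<close>, where they are
  the pointwise operations.
\<close>

definition L_generated :: "('a, 'm) monoid_scheme \<Rightarrow> ('a \<Rightarrow> 'l::complete_distrib_lattice) \<Rightarrow>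
    ('a \<Rightarrow> 'l) \<Rightarrow> ('a \<Rightarrow> 'l) \<Rightarrow> 'a \<Rightarrow> 'l"
  where "L_generated G \<mu> \<eta> \<nu> = Inf {\<theta>. L_subgroup_of G \<mu> \<theta> \<and> L_included G (sup \<eta> \<nu>) \<theta>}"

definition abnormal_L_subgroup ::
    "('a, 'm) monoid_scheme \<Rightarrow> ('a \<Rightarrow> 'l::complete_distrib_lattice) \<Rightarrow> ('a \<Rightarrow> 'l) \<Rightarrow> bool"
  where "abnormal_L_subgroup G \<mu> \<eta> \<longleftrightarrow> L_subgroup_of G \<mu> \<eta> \<and>
    (\<forall>a. \<forall>x\<in>carrier G. L_point_in a x \<mu> \<longrightarrow>
      L_point_in a x (L_generated G \<mu> \<eta> (L_conjugate G \<eta> a x)))"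

definition L_normalizer :: "('a, 'm) monoid_scheme \<Rightarrow> ('a \<Rightarrow> 'l::complete_distrib_lattice) \<Rightarrow>
    ('a \<Rightarrow> 'l) \<Rightarrow> 'a \<Rightarrow> 'l"
  where "L_normalizer G \<mu> \<eta> = Sup {L_point a z |a z.
    z \<in> carrier G \<and> L_point_in a z \<mu> \<and> L_included G (L_conjugate G \<eta> a z) \<eta>}"

end

theory Submission
  imports Defs
begin

text \<open>If a point of \<mu> with value a at z conjugates \<eta> into \<eta>, then \<eta> already
  contains both \<eta> and its conjugate, so the L-subgroup they generate lies below \<eta>
  (\<open>L_generated_le\<close>); abnormality puts the point in that L-subgroup, whence a \<le>
  \<eta> z. Conversely, points of \<eta> conjugate \<eta> into itself
  (\<open>L_conjugate_included\<close>), so they occur in the supremum defining the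
  normalizer.\<close>

lemma L_conjugate_included:
  assumes "group G" and \<eta>: "L_subgroup G \<eta>" and z: "z \<in> carrier G" and a: "a \<le> \<eta> z"
  shows "L_included G (L_conjugate G \<eta> a z) \<eta>"
  unfolding L_included_def L_conjugate_def
proof
  interpret group G by fact
  fix x assume x: "x \<in> carrier G"
  let ?c = "z \<otimes>\<^bsub>G\<^esub> x \<otimes>\<^bsub>G\<^esub> inv\<^bsub>G\<^esub> z"
  have mult: "inf (\<eta> u) (\<eta> v) \<le> \<eta> (u \<otimes>\<^bsub>G\<^esub> v)" if "u \<in> carrier G" "v \<in> carrier G" for u v
    using \<eta> that by (simp add: L_subgroup_def)
  have inv: "\<eta> (inv\<^bsub>G\<^esub> z) = \<eta> z"
    using \<eta> z by (simp add: L_subgroup_def)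
  \<comment> \<open>Write x as the product of \<open>inv z\<close>, \<open>?c\<close> and z; a
    bounds \<eta> from below at both outer factors.\<close>
  have "inf a (\<eta> ?c) \<le> inf (inf (\<eta> (inv\<^bsub>G\<^esub> z)) (\<eta> ?c)) (\<eta> z)"
    using a inv by (simp add: le_infI1)
  also have "\<dots> \<le> inf (\<eta> (inv\<^bsub>G\<^esub> z \<otimes>\<^bsub>G\<^esub> ?c)) (\<eta> z)"
    using mult x z by (intro inf_mono) auto
  also have "\<dots> \<le> \<eta> (inv\<^bsub>G\<^esub> z \<otimes>\<^bsub>G\<^esub> ?c \<otimes>\<^bsub>G\<^esub> z)"
    using mult x z by auto
  also have "inv\<^bsub>G\<^esub> z \<otimes>\<^bsub>G\<^esub> ?c \<otimes>\<^bsub>G\<^esub> z = x"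
    using x z by (simp add: m_assoc inv_solve_left')
  finally show "inf a (\<eta> ?c) \<le> \<eta> x" .
qed

text \<open>\<eta> is itself one of the L-subgroups over which the infimum is taken.\<close>

lemma L_generated_le:
  assumes "L_subgroup_of G \<mu> \<eta>" and "L_included G \<nu> \<eta>"
  shows "L_generated G \<mu> \<eta> \<nu> x \<le> \<eta> x"
proof -
  have "L_generated G \<mu> \<eta> \<nu> \<le> \<eta>"
    unfolding L_generated_def using assms by (intro Inf_lower) (simp add: L_included_def)
  then show ?thesis
    by (rule le_funD)
qed

theorem theorem3p14:
  fixes G :: "('a, 'm) monoid_scheme"
    and \<mu> \<eta> :: "'a \<Rightarrow> 'l::complete_distrib_lattice"
  assumes "group G"
    and "L_subgroup G \<mu>"
    and "abnormal_L_subgroup G \<mu> \<eta>"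
  shows "L_equal G (L_normalizer G \<mu> \<eta>) \<eta>"
  unfolding L_equal_def
proof (intro ballI antisym)
  fix x assume x: "x \<in> carrier G"
  have sub: "L_subgroup_of G \<mu> \<eta>"
    using assms(3) by (simp add: abnormal_L_subgroup_def)
  \<comment> \<open>This can be shown for total functions, not just on the carrier, because each
    point is \<open>bot\<close> away from its support.\<close>
  have "L_normalizer G \<mu> \<eta> \<le> \<eta>"
    unfolding L_normalizer_def
  proof (rule Sup_least, clarify)
    fix a z
    assume z: "z \<in> carrier G" and "L_point_in a z \<mu>"
      and conj: "L_included G (L_conjugate G \<eta> a z) \<eta>"
    then have "a \<le> L_generated G \<mu> \<eta> (L_conjugate G \<eta> a z) z"
      using assms(3) by (simp add: abnormal_L_subgroup_def L_point_in_def)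
    also have "\<dots> \<le> \<eta> z"
      using sub conj by (rule L_generated_le)
    finally show "L_point a z \<le> \<eta>"
      by (simp add: L_point_def le_fun_def)
  qed
  then show "L_normalizer G \<mu> \<eta> x \<le> \<eta> x"
    by (rule le_funD)
  \<comment> \<open>The value \<eta> x is the witness: the point with this value at x lies in
    \<eta>, hence in \<mu>, and conjugates \<eta> into itself.\<close>
  have "L_included G (L_conjugate G \<eta> (\<eta> x) x) \<eta>"
    using assms(1) sub x by (simp add: L_conjugate_included L_subgroup_of_def)
  moreover have "L_point_in (\<eta> x) x \<mu>"
    using sub x by (simp add: L_subgroup_of_def L_included_def L_point_in_def)
  ultimately have "L_point (\<eta> x) x \<le> L_normalizer G \<mu> \<eta>"
    unfolding L_normalizer_def using x by (intro Sup_upper) blast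
  from le_funD[OF this, of x] show "\<eta> x \<le> L_normalizer G \<mu> \<eta> x"
    by (simp add: L_point_def)
qed

end
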